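(* Let $A,B_1,\ldots,B_m\in\mathcal{M}_D^{\mathrm{sym}}$, $\eta,\gamma_1,\ldots,\gamma_m\in\mathbb{R}$ and $\epsilon>0$. Denote by $\alpha$ the value of the sketchable SDP defined by $A,B_1,\ldots,B_m,\gamma_1,\ldots,\gamma_m$ and assume that it is attained at an optimal point $X^*$ which satisfies $\operatorname{Tr}(X^* )\le\eta$. Moreover, let $S\in\mathbb{R}^{d\times D}$ be an $(\epsilon,\delta,k)$-Johnson-Lindenstrauss transform, with $$k\ \ge\ \operatorname{rank}(X^* )+\operatorname{rank}(A)+\sum_{i=1}^m\operatorname{rank}(B_i).$$ Let $\alpha_S$ be the value of the sketched SDP defined by $A$, $B_i$ and $S$ (with the given $\gamma_i$, $\eta$, $\epsilon$). Then $$\alpha_S+3\epsilon\eta\|A\|_1\ \ge\ \alpha$$ with probability at least $1-\delta$.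
   Context: $\mathcal{M}_D^{\mathrm{sym}}$ is the set of real symmetric $D\times D$ matrices; $X\ge0$ means that the symmetric matrix $X$ is positive semidefinite; $\|A\|_1=\operatorname{Tr}[(A^TA)^{1/2}]$ is the Schatten $1$-norm. The sketchable SDP (semidefinite program) is: maximize $\operatorname{Tr}(AX)$ subject to $\operatorname{Tr}(B_iX)\le\gamma_i$ for $i=1,\ldots,m$, and $X\ge0$, over $X\in\mathcal{M}_D^{\mathrm{sym}}$. For a random matrix $S\in\mathbb{R}^{d\times D}$, the sketched SDP is: maximize $\operatorname{Tr}(SAS^TY)$ subject to $\operatorname{Tr}(SB_iS^TY)\le\gamma_i+\mu\|B_i\|_1$ for $i=1,\ldots,m$, and $Y\ge0$, over $Y\in\mathcal{M}_d^{\mathrm{sym}}$, where $\mu=3\epsilon\eta$. The value of such a problem is the supremum of its objective over feasible points. A random matrix $S\in\mathbb{R}^{d\times D}$ is a Johnson-Lindenstrauss transform with parameters $(\epsilon,\delta,k)$ if for any $k$-element subset $V\subseteq\mathbb{R}^D$, with probability at least $1-\delta$, it holds for all $v,w\in V$ that $|\langle Sv,Sw\rangle-\langle v,w\rangle|\le\epsilon\|v\|_2\|w\|_2$. *)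

theory Defs
  imports "HOL-Probability.Probability"
begin

definition symmetric_mat :: "real^'n^'n \<Rightarrow> bool" where
  "symmetric_mat X \<longleftrightarrow> transpose X = X"

definition psd :: "real^'n^'n \<Rightarrow> bool" where
  "psd X \<longleftrightarrow> symmetric_mat X \<and> (\<forall>x. 0 \<le> x \<bullet> (X *v x))"

text \<open>The positive semidefinite square root; it exists and is unique for positive
  semidefinite \<open>P\<close>, and the definition is only meaningful for such \<open>P\<close>.\<close>

definition psd_sqrt :: "real^'n^'n \<Rightarrow> real^'n^'n" where
  "psd_sqrt P = (THE R. psd R \<and> R ** R = P)"

definition schatten1 :: "real^'n^'n \<Rightarrow> real" where
  "schatten1 A = trace (psd_sqrt (transpose A ** A))"

text \<open>The semidefinite program: maximize \<open>trace (A ** X)\<close> subject to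
  \<open>trace (B i ** X) \<le> \<gamma> i\<close> for \<open>i = 1, \<dots>, m\<close> and \<open>X\<close> positive semidefinite.
  Values of \<open>B\<close> and \<open>\<gamma>\<close> outside \<open>{1..m}\<close> are irrelevant. The value is taken in the
  extended reals: it is \<open>-\<infinity>\<close> if the program is infeasible and \<open>\<infinity>\<close> if it is unbounded.\<close>

definition sdp_feasible :: "nat \<Rightarrow> (nat \<Rightarrow> real^'n^'n) \<Rightarrow> (nat \<Rightarrow> real) \<Rightarrow> (real^'n^'n) set" where
  "sdp_feasible m B \<gamma> = {X. psd X \<and> (\<forall>i\<in>{1..m}. trace (B i ** X) \<le> \<gamma> i)}"

definition sdp_value ::
    "nat \<Rightarrow> real^'n^'n \<Rightarrow> (nat \<Rightarrow> real^'n^'n) \<Rightarrow> (nat \<Rightarrow> real) \<Rightarrow> ereal" where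
  "sdp_value m A B \<gamma> = (SUP X\<in>sdp_feasible m B \<gamma>. ereal (trace (A ** X)))"

definition sdp_optimal ::
    "nat \<Rightarrow> real^'n^'n \<Rightarrow> (nat \<Rightarrow> real^'n^'n) \<Rightarrow> (nat \<Rightarrow> real) \<Rightarrow> real^'n^'n \<Rightarrow> bool" where
  "sdp_optimal m A B \<gamma> X \<longleftrightarrow>
     X \<in> sdp_feasible m B \<gamma> \<and> ereal (trace (A ** X)) = sdp_value m A B \<gamma>"

definition sketch :: "real^'n^'d \<Rightarrow> real^'n^'n \<Rightarrow> real^'d^'d" where
  "sketch S A = S ** A ** transpose S"

definition sketched_sdp_value ::
    "nat \<Rightarrow> real^'n^'n \<Rightarrow> (nat \<Rightarrow> real^'n^'n) \<Rightarrow> (nat \<Rightarrow> real) \<Rightarrow> real \<Rightarrow> real \<Rightarrow> real^'n^'d \<Rightarrow> ereal" where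
  "sketched_sdp_value m A B \<gamma> \<eta> \<epsilon> S =
     (let \<mu> = 3 * \<epsilon> * \<eta> in
      sdp_value m (sketch S A) (\<lambda>i. sketch S (B i)) (\<lambda>i. \<gamma> i + \<mu> * schatten1 (B i)))"

text \<open>A random \<open>d \<times> D\<close> matrix is a Borel measurable map from a probability space \<open>M\<close>
  into the matrices; the probability bound is required for each \<open>V\<close> separately.\<close>

definition jl_transform ::
    "'w measure \<Rightarrow> ('w \<Rightarrow> real^'n^'d) \<Rightarrow> real \<Rightarrow> real \<Rightarrow> nat \<Rightarrow> bool" where
  "jl_transform M S \<epsilon> \<delta> k \<longleftrightarrow>
     prob_space M \<and> S \<in> borel_measurable M \<and>
     (\<forall>V. finite V \<and> card V = k \<longrightarrow>
        measure M {\<omega> \<in> space M. \<forall>v\<in>V. \<forall>w\<in>V.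
          \<bar>(S \<omega> *v v) \<bullet> (S \<omega> *v w) - v \<bullet> w\<bar> \<le> \<epsilon> * norm v * norm w} \<ge> 1 - \<delta>)"

end

theory Submission
  imports Defs
begin

text \<open>Spectral decompositions \<open>A = \<Sum> a\<^sub>v v v\<^sup>T\<close> and \<open>X = \<Sum> b\<^sub>u u u\<^sup>T\<close> into unit eigenvectors give
  \<open>Tr (SAS\<^sup>T SXS\<^sup>T) - Tr (AX) = \<Sum> a\<^sub>v b\<^sub>u (\<langle>Sv, Su\<rangle>\<^sup>2 - \<langle>v, u\<rangle>\<^sup>2)\<close>. If \<open>S\<close> preserves the inner products
  of all these vectors up to \<open>\<epsilon> \<le> 1\<close>, the difference is at most \<open>3 \<epsilon> \<parallel>A\<parallel>\<^sub>1 \<parallel>X\<parallel>\<^sub>1\<close>, so the sketch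
  of the optimal point is feasible and nearly optimal. For \<open>\<epsilon> > 1\<close> the point \<open>0\<close> is.
  As a non-measurable event has measure 0 by convention, the value of the sketched
  program also has to be shown to be Borel measurable in \<open>S\<close>.\<close>

section \<open>Spectral theorem for self-adjoint maps\<close>

text \<open>First-order condition at a minimum: near \<open>t = 0\<close> the linear term dominates,
  so a nonzero \<open>b\<close> would give a negative value at a small \<open>t\<close> of sign
  opposite to \<open>b\<close>.\<close>

lemma quadratic_nonneg_linear_coeff:
  fixes b c :: real
  assumes "\<And>t. 0 \<le> 2 * t * b + t\<^sup>2 * c"
  shows "b = 0"
proof (rule ccontr)
  assume b: "b \<noteq> 0"
  \<comment> \<open>At \<open>t = - s * b\<close> the expression is
    \<open>s * b^2 * (s * c - 2)\<close>; this \<open>s\<close> is small enough that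
    \<open>s * c \<le> 1\<close>.\<close>
  define s where "s = 1 / (\<bar>c\<bar> + 1)"
  have s: "s > 0" and "s * (\<bar>c\<bar> + 1) = 1" by (auto simp: s_def)
  then have "s * c \<le> 1"
    by (smt (verit) mult_left_mono)
  have "0 \<le> 2 * (- s * b) * b + (- s * b)\<^sup>2 * c" by (rule assms)
  also have "\<dots> = s * b\<^sup>2 * (s * c - 2)" by (simp add: power2_eq_square algebra_simps)
  also have "\<dots> < 0"
    using s b \<open>s * c \<le> 1\<close> by (intro mult_pos_neg mult_pos_pos) auto
  finally show False by simp
qed

text \<open>A maximizer of the Rayleigh quotient on an invariant subspace is an eigenvector.\<close>

lemma self_adjoint_eigenvector_exists:
  fixes f :: "'a::euclidean_space \<Rightarrow> 'a"
  assumes lin: "linear f" and sa: "\<And>x y. f x \<bullet> y = x \<bullet> f y"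
    and V: "subspace V" "f ` V \<subseteq> V" "\<exists>x\<in>V. x \<noteq> 0"
  shows "\<exists>v\<in>V. norm v = 1 \<and> (\<exists>c. f v = c *\<^sub>R v)"
proof -
  interpret f: linear f by (rule lin)
  let ?K = "V \<inter> sphere 0 1"
  have cont: "continuous_on ?K (\<lambda>x. x \<bullet> f x)"
    by (intro continuous_intros linear_continuous_on linear_linear[THEN iffD2] lin)
  obtain x where x: "x \<in> V" "x \<noteq> 0" using V by blast
  have "(1 / norm x) *\<^sub>R x \<in> ?K"
    using x V(1) by (simp add: subspace_scale)
  then have "?K \<noteq> {}" by blast
  moreover have "compact ?K"
    using closed_subspace[OF V(1)] by (simp add: closed_Int_compact)
  ultimately obtain v where v: "v \<in> ?K" and vmax: "\<And>y. y \<in> ?K \<Longrightarrow> y \<bullet> f y \<le> v \<bullet> f v"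
    using continuous_attains_sup[OF _ _ cont] by blast
  define c where "c = v \<bullet> f v"
  have vv: "v \<bullet> v = 1" "v \<in> V" "norm v = 1" using v by (auto simp: norm_eq_1)
  have le: "y \<bullet> f y \<le> c * (y \<bullet> y)" if "y \<in> V" for y
  proof (cases "y = 0")
    case False
    have "(1 / norm y) *\<^sub>R y \<in> ?K"
      using that False V(1) by (simp add: subspace_scale)
    from vmax[OF this] have "(y \<bullet> f y) / (norm y * norm y) \<le> c"
      by (simp add: f.scale c_def)
    then show ?thesis
      using False by (simp add: divide_le_eq power2_norm_eq_inner[symmetric] power2_eq_square)
  qed simp
  \<comment> \<open>Up to a factor, \<open>w\<close> is the derivative at \<open>v\<close> of the
    nonnegative function \<open>c * (y \<bullet> y) - y \<bullet> f y\<close>, which vanishes at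
    \<open>v\<close>. Moving from \<open>v\<close> in direction \<open>w\<close> makes the linear
    coefficient \<open>w \<bullet> w\<close>, so it must be zero.\<close>
  define w where "w = c *\<^sub>R v - f v"
  have wV: "w \<in> V"
    using V vv(2) unfolding w_def by (intro subspace_diff subspace_scale) auto
  have "0 \<le> 2 * t * (w \<bullet> w) + t\<^sup>2 * (c * (w \<bullet> w) - w \<bullet> f w)" for t
  proof -
    have "v + t *\<^sub>R w \<in> V" using V vv(2) wV by (intro subspace_add subspace_scale)
    from le[OF this] have "0 \<le> c * ((v + t *\<^sub>R w) \<bullet> (v + t *\<^sub>R w)) - (v + t *\<^sub>R w) \<bullet> f (v + t *\<^sub>R w)"
      by simp
    also have "\<dots> = 2 * t * (c * (v \<bullet> w) - f v \<bullet> w) + t\<^sup>2 * (c * (w \<bullet> w) - w \<bullet> f w)"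
      using sa[of v w] sa[of w v]
      by (simp add: f.add f.scale inner_simps vv c_def[symmetric] inner_commute
          power2_eq_square algebra_simps)
    also have "c * (v \<bullet> w) - f v \<bullet> w = w \<bullet> w"
      by (simp add: w_def inner_diff_left)
    finally show ?thesis .
  qed
  then have "w \<bullet> w = 0" by (rule quadratic_nonneg_linear_coeff)
  then have "f v = c *\<^sub>R v" by (simp add: w_def)
  then show ?thesis using vv by blast
qed

text \<open>An orthonormal set of eigenvectors of maximal cardinality spans. Otherwise its
  orthogonal complement is nonzero and, by self-adjointness, invariant under \<open>f\<close>, so it
  contains a further unit eigenvector.\<close>

theorem self_adjoint_eigenbasis:
  fixes f :: "'a::euclidean_space \<Rightarrow> 'a"
  assumes lin: "linear f" and sa: "\<And>x y. f x \<bullet> y = x \<bullet> f y"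
  obtains E a where "finite E" "pairwise orthogonal E" "\<And>v. v \<in> E \<Longrightarrow> norm v = 1"
    "span E = UNIV" "\<And>v. v \<in> E \<Longrightarrow> f v = a v *\<^sub>R v"
proof -
  define Q where "Q E \<longleftrightarrow> pairwise orthogonal E \<and> (\<forall>v\<in>E. norm v = 1 \<and> (\<exists>c. f v = c *\<^sub>R v))"
    for E :: "'a set"
  have bound: "card E < Suc DIM('a)" "finite E" if "Q E" for E
  proof -
    have "0 \<notin> E" using that by (auto simp: Q_def)
    with that have "independent E"
      using pairwise_orthogonal_independent by (auto simp: Q_def)
    then show "card E < Suc DIM('a)" "finite E"
      using independent_bound by (auto simp: less_Suc_eq_le)
  qed
  have "Q {}" by (simp add: Q_def pairwise_def)
  then obtain E where E: "Q E" and mx: "\<And>F. Q F \<Longrightarrow> card F \<le> card E"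
    using ex_has_greatest_nat[of Q "{}" card "Suc DIM('a)"] bound by (metis less_imp_le)
  have "span E = UNIV"
  proof (rule ccontr)
    assume "span E \<noteq> UNIV"
    then have "dim E < DIM('a)"
      using dim_eq_full[of E] dim_subset_UNIV[of E] by fastforce
    then obtain x where x: "x \<noteq> 0" "\<And>y. y \<in> span E \<Longrightarrow> orthogonal x y"
      using orthogonal_to_subspace_exists by blast
    let ?V = "{y. \<forall>x\<in>E. orthogonal x y}"
    have "f ` ?V \<subseteq> ?V"
    proof clarify
      fix y e assume y: "\<forall>x\<in>E. orthogonal x y" and "e \<in> E"
      then obtain c where "f e = c *\<^sub>R e" using E by (auto simp: Q_def)
      then show "orthogonal e (f y)"
        using y \<open>e \<in> E\<close> sa[of e y] by (simp add: orthogonal_def)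
    qed
    moreover have "x \<in> ?V" using x by (auto simp: orthogonal_commute span_base)
    ultimately have "\<exists>v\<in>?V. norm v = 1 \<and> (\<exists>c. f v = c *\<^sub>R v)"
      using x(1)
      by (intro self_adjoint_eigenvector_exists[OF lin sa subspace_orthogonal_to_vectors]) auto
    then obtain v where v: "v \<in> ?V" "norm v = 1" "\<exists>c. f v = c *\<^sub>R v"
      by blast
    have "v \<notin> E" using v by (auto simp: orthogonal_def)
    moreover have "Q (insert v E)"
      using E v by (auto simp: Q_def pairwise_insert orthogonal_commute)
    ultimately show False
      using mx[of "insert v E"] bound[OF E] by simp
  qed
  moreover obtain a where "\<And>v. v \<in> E \<Longrightarrow> f v = a v *\<^sub>R v"
    using E unfolding Q_def by metis
  ultimately show thesis
    using that[of E a] E bound[OF E] by (auto simp: Q_def)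
qed

section \<open>Sums of rank-one matrices \<open>v v^T\<close> and their traces\<close>

definition outer :: "real^'n \<Rightarrow> real^'n^'n" where
  "outer v = (\<chi> i j. v $ i * v $ j)"

lemma outer_mult_vec: "outer v *v x = (v \<bullet> x) *\<^sub>R v"
  by (simp add: outer_def matrix_vector_mult_def inner_vec_def vec_eq_iff sum_distrib_left
      sum_distrib_right mult_ac)

lemma matrix_sum_mult_vec:
  fixes f :: "'a \<Rightarrow> real^'n^'m"
  shows "(\<Sum>i\<in>I. f i) *v x = (\<Sum>i\<in>I. f i *v x)"
  by (induction I rule: infinite_finite_induct) (auto simp: matrix_vector_mult_add_rdistrib)

lemma trace_sum: "trace (\<Sum>i\<in>I. f i :: real^'n^'n) = (\<Sum>i\<in>I. trace (f i))"
  by (induction I rule: infinite_finite_induct) (auto simp: trace_add trace_def[of 0])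

lemma trace_scaleR: "trace (c *\<^sub>R A :: real^'n^'n) = c * trace A"
  by (simp add: trace_def sum_distrib_left)

lemma trace_outer: "trace (outer v) = v \<bullet> v"
  by (simp add: trace_def outer_def inner_vec_def)

lemma symmetric_mat_outer_sum: "symmetric_mat (\<Sum>v\<in>E. a v *\<^sub>R outer (h v))"
  by (simp add: symmetric_mat_def transpose_def vec_eq_iff outer_def mult_ac)

lemma outer_sum_mult_vec:
  "(\<Sum>v\<in>E. a v *\<^sub>R outer (h v)) *v x = (\<Sum>v\<in>E. (a v * (h v \<bullet> x)) *\<^sub>R h v)"
  by (simp add: matrix_sum_mult_vec scaleR_matrix_vector_assoc[symmetric] outer_mult_vec)

lemma psd_outer_sum:
  assumes "\<And>v. v \<in> E \<Longrightarrow> 0 \<le> a v"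
  shows "psd (\<Sum>v\<in>E. a v *\<^sub>R outer (h v))"
proof -
  have "x \<bullet> ((\<Sum>v\<in>E. a v *\<^sub>R outer (h v)) *v x) = (\<Sum>v\<in>E. a v * (h v \<bullet> x)\<^sup>2)" for x
    by (simp add: outer_sum_mult_vec inner_sum_right inner_commute power2_eq_square mult_ac)
  then show ?thesis
    using assms by (auto simp: psd_def symmetric_mat_outer_sum intro!: sum_nonneg)
qed

text \<open>Since \<open>S v v^T S^T = (S v)(S v)^T\<close>, sketching keeps the coefficients and
  only moves the vectors.\<close>

lemma sketch_outer_sum:
  "sketch S (\<Sum>v\<in>E. a v *\<^sub>R outer v) = (\<Sum>v\<in>E. a v *\<^sub>R outer (S *v v))"
proof -
  have "sketch S (\<Sum>v\<in>E. a v *\<^sub>R outer v) *v x = (\<Sum>v\<in>E. a v *\<^sub>R outer (S *v v)) *v x" for x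
  proof -
    have "sketch S (\<Sum>v\<in>E. a v *\<^sub>R outer v) *v x
        = S *v ((\<Sum>v\<in>E. a v *\<^sub>R outer v) *v (transpose S *v x))"
      unfolding sketch_def by (simp only: matrix_vector_mul_assoc matrix_mul_assoc)
    also have "\<dots> = (\<Sum>v\<in>E. (a v * (v \<bullet> (x v* S))) *\<^sub>R (S *v v))"
      using outer_sum_mult_vec[of a "\<lambda>v. v"]
      by (simp add: linear_sum[OF matrix_vector_mul_linear] matrix_vector_mult_scaleR)
    also have "\<dots> = (\<Sum>v\<in>E. a v *\<^sub>R outer (S *v v)) *v x"
      by (simp add: outer_sum_mult_vec dot_lmul_matrix inner_commute[of _ "x v* S"] inner_commute[of _ x])
    finally show ?thesis .
  qed
  then show ?thesis by (simp add: matrix_eq)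
qed

lemma trace_outer_mult: "trace (outer v ** X) = v \<bullet> (X *v v)"
proof -
  have "trace (outer v ** X) = (\<Sum>i\<in>UNIV. \<Sum>k\<in>UNIV. v $ i * v $ k * X $ k $ i)"
    by (simp add: trace_def matrix_matrix_mult_def outer_def)
  also have "\<dots> = (\<Sum>k\<in>UNIV. \<Sum>i\<in>UNIV. v $ i * v $ k * X $ k $ i)"
    by (rule sum.swap)
  also have "\<dots> = v \<bullet> (X *v v)"
    by (simp add: inner_vec_def matrix_vector_mult_def sum_distrib_left mult_ac)
  finally show ?thesis .
qed

lemma trace_sum_mult:
  "trace ((\<Sum>i\<in>I. a i *\<^sub>R f i) ** X) = (\<Sum>i\<in>I. a i * trace (f i ** X :: real^'n^'n))"
proof (induction I rule: infinite_finite_induct)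
  case (insert i I)
  have "trace ((a i *\<^sub>R f i + C) ** X) = a i * trace (f i ** X) + trace (C ** X)" for C
    by (simp add: trace_def matrix_matrix_mult_def sum.distrib sum_distrib_left ring_distribs mult_ac)
  then show ?case using insert by simp
qed (simp_all add: trace_def matrix_matrix_mult_def)

text \<open>Bilinearity reduces this to \<open>Tr (v v^T u u^T) = (v \<bullet> u)^2\<close>. The
  maps \<open>g\<close> and \<open>h\<close> cover the original vectors and the sketched ones
  alike.\<close>

lemma trace_outer_sums:
  "trace ((\<Sum>v\<in>E. a v *\<^sub>R outer (g v)) ** (\<Sum>u\<in>F. b u *\<^sub>R outer (h u)))
     = (\<Sum>v\<in>E. \<Sum>u\<in>F. a v * b u * (g v \<bullet> h u)\<^sup>2)"
  by (simp add: trace_sum_mult trace_outer_mult outer_sum_mult_vec inner_sum_right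
      sum_distrib_left power2_eq_square inner_commute mult_ac)

section \<open>Spectral decomposition and the Schatten norm\<close>

lemma eigenbasis_decomposition:
  assumes "finite E" "pairwise orthogonal E" "\<And>v. v \<in> E \<Longrightarrow> norm v = 1" "span E = UNIV"
    and eig: "\<And>v. v \<in> E \<Longrightarrow> A *v v = a v *\<^sub>R v"
  shows "A = (\<Sum>v\<in>E. a v *\<^sub>R outer v)"
proof -
  have "A *v x = (\<Sum>v\<in>E. a v *\<^sub>R outer v) *v x" if "x \<in> E" for x
  proof -
    have "(\<Sum>v\<in>E. a v *\<^sub>R outer v) *v x = (\<Sum>v\<in>E. (a v * (v \<bullet> x)) *\<^sub>R v)"
      by (rule outer_sum_mult_vec)
    also have "\<dots> = (\<Sum>v\<in>E. if v = x then a v *\<^sub>R v else 0)"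
    proof (intro sum.cong refl)
      fix v assume "v \<in> E"
      then have "v \<bullet> x = (if v = x then 1 else 0)"
        using assms(2) assms(3)[OF that] that
        by (auto simp: pairwise_def orthogonal_def norm_eq_1)
      then show "(a v * (v \<bullet> x)) *\<^sub>R v = (if v = x then a v *\<^sub>R v else 0)" by simp
    qed
    also have "\<dots> = A *v x" using that assms(1) eig by simp
    finally show ?thesis by simp
  qed
  then have "A *v x = (\<Sum>v\<in>E. a v *\<^sub>R outer v) *v x" for x
    using linear_eq_on_span[OF matrix_vector_mul_linear matrix_vector_mul_linear, of E A _ x] assms(4)
    by blast
  then show ?thesis by (simp add: matrix_eq)
qed

lemma symmetric_mat_dot: "symmetric_mat A \<Longrightarrow> (A *v x) \<bullet> y = x \<bullet> (A *v y)"
  by (metis dot_lmul_matrix symmetric_mat_def transpose_matrix_vector)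

corollary symmetric_mat_eigenbasis:
  fixes A :: "real^'n^'n"
  assumes "symmetric_mat A"
  obtains E a where "finite E" "pairwise orthogonal E" "\<And>v. v \<in> E \<Longrightarrow> norm v = 1"
    "span E = UNIV" "\<And>v. v \<in> E \<Longrightarrow> A *v v = a v *\<^sub>R v"
  using self_adjoint_eigenbasis[OF matrix_vector_mul_linear, of A] symmetric_mat_dot[OF assms]
  by blast

text \<open>It suffices that \<open>Q\<close> acts on an eigenbasis of \<open>R\<close> as
  \<open>R\<close> does.\<close>

lemma psd_sqrt_unique:
  fixes R Q :: "real^'n^'n"
  assumes R: "psd R" and Q: "psd Q" and eq: "R ** R = Q ** Q"
  shows "R = Q"
proof -
  obtain E a where E: "finite E" "pairwise orthogonal E" "\<And>v. v \<in> E \<Longrightarrow> norm v = 1"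
    "span E = UNIV" "\<And>v. v \<in> E \<Longrightarrow> R *v v = a v *\<^sub>R v"
    using symmetric_mat_eigenbasis[of R] R by (auto simp: psd_def)
  have "Q *v v = a v *\<^sub>R v" if v: "v \<in> E" for v
  proof -
    have a: "0 \<le> a v"
      using R E(3)[OF v] E(5)[OF v] unfolding psd_def norm_eq_1 by (metis inner_scaleR_right mult.right_neutral)
    define w where "w = Q *v v - a v *\<^sub>R v"
    have "Q *v (Q *v v) = R *v (R *v v)" by (simp add: matrix_vector_mul_assoc eq)
    \<comment> \<open>This is \<open>(Q + a)(Q - a) v = 0\<close>. A positive semidefinite
      \<open>Q\<close> has no eigenvalue \<open>- a < 0\<close>, hence \<open>w = 0\<close> when
      \<open>a > 0\<close>.\<close>
    then have Qw: "Q *v w = - (a v *\<^sub>R w)"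
      by (simp add: w_def matrix_vector_mult_diff_distrib matrix_vector_mult_scaleR E(5)[OF v] algebra_simps)
    have "0 \<le> w \<bullet> (Q *v w)" using Q by (simp add: psd_def)
    then have "a v * (w \<bullet> w) \<le> 0" by (simp add: Qw)
    then consider "w = 0" | "a v = 0"
      using a by (metis inner_gt_zero_iff mult_pos_pos not_le order_le_less)
    then show ?thesis
    proof cases
      \<comment> \<open>For \<open>a v = 0\<close> the sign argument says nothing; instead
        \<open>Q (Q v) = 0\<close> yields \<open>Q v = 0\<close> by symmetry of
        \<open>Q\<close>.\<close>
      case 2
      then have "Q *v (Q *v v) = 0" using Qw by (simp add: w_def)
      then have "(Q *v v) \<bullet> (Q *v v) = 0"
        using Q symmetric_mat_dot[of Q v "Q *v v"] by (simp add: psd_def)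
      then show ?thesis using 2 by simp
    qed (simp add: w_def)
  qed
  then show ?thesis
    using eigenbasis_decomposition[OF E(1-4), of R a] eigenbasis_decomposition[OF E(1-4), of Q a] E(5)
    by simp
qed

lemma psd_sqrt_eqI: "psd R \<Longrightarrow> R ** R = P \<Longrightarrow> psd_sqrt P = R"
  unfolding psd_sqrt_def by (rule the_equality) (auto intro: psd_sqrt_unique)

text \<open>Replacing each eigenvalue by its absolute value gives a positive semidefinite matrix
  with square \<open>A^T A\<close>, as seen on the eigenbasis. By uniqueness it is the square root
  in the norm.\<close>

lemma schatten1_eq_sum_eigenvalues:
  fixes A :: "real^'n^'n"
  assumes "symmetric_mat A"
    and E: "finite E" "pairwise orthogonal E" "\<And>v. v \<in> E \<Longrightarrow> norm v = 1" "span E = UNIV"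
    and eig: "\<And>v. v \<in> E \<Longrightarrow> A *v v = a v *\<^sub>R v"
  shows "schatten1 A = (\<Sum>v\<in>E. \<bar>a v\<bar>)"
proof -
  define R where "R = (\<Sum>v\<in>E. \<bar>a v\<bar> *\<^sub>R outer v)"
  have R: "R *v v = \<bar>a v\<bar> *\<^sub>R v" if "v \<in> E" for v
  proof -
    have "(\<bar>a u\<bar> * (u \<bullet> v)) *\<^sub>R u = (if u = v then \<bar>a v\<bar> *\<^sub>R v else 0)" if "u \<in> E" for u
      using E(2) E(3)[OF \<open>v \<in> E\<close>] that \<open>v \<in> E\<close> by (auto simp: pairwise_def orthogonal_def norm_eq_1)
    then show ?thesis
      using that E(1) by (simp add: R_def outer_sum_mult_vec cong: sum.cong)
  qed
  have "(R ** R) *v x = (A ** A) *v x" if "x \<in> E" for x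
    using that by (simp add: matrix_vector_mul_assoc[symmetric] R eig matrix_vector_mult_scaleR)
  then have "(R ** R) *v x = (A ** A) *v x" for x
    using linear_eq_on_span[OF matrix_vector_mul_linear matrix_vector_mul_linear, of E "R ** R" "A ** A" x] E(4)
    by blast
  then have "R ** R = transpose A ** A"
    using assms(1) unfolding symmetric_mat_def by (metis matrix_eq)
  moreover have "psd R"
    unfolding R_def using psd_outer_sum[of E "\<lambda>v. \<bar>a v\<bar>" "\<lambda>v. v"] by simp
  ultimately have "schatten1 A = trace R" by (simp add: schatten1_def psd_sqrt_eqI)
  also have "\<dots> = (\<Sum>v\<in>E. \<bar>a v\<bar>)"
    using E(3) by (simp add: R_def trace_sum trace_scaleR trace_outer norm_eq_1)
  finally show ?thesis .
qed

text \<open>Packages what the trace estimates take from a spectral decomposition. \<open>E\<close>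
  may omit the kernel of \<open>A\<close>, so that its size can be bounded by the rank.\<close>

definition unit_decomposition :: "real^'n^'n \<Rightarrow> (real^'n) set \<Rightarrow> (real^'n \<Rightarrow> real) \<Rightarrow> bool" where
  "unit_decomposition A E a \<longleftrightarrow> finite E \<and> (\<forall>v\<in>E. norm v = 1) \<and>
     A = (\<Sum>v\<in>E. a v *\<^sub>R outer v) \<and> schatten1 A = (\<Sum>v\<in>E. \<bar>a v\<bar>)"

text \<open>Eigenvectors with nonzero eigenvalue lie in the range of \<open>A\<close> and are
  independent. This is the source of the ranks in the bound on \<open>k\<close>.\<close>

lemma symmetric_mat_unit_decomposition:
  fixes A :: "real^'n^'n"
  assumes "symmetric_mat A"
  shows "\<exists>E a. unit_decomposition A E a \<and> card E \<le> rank A"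
proof -
  obtain E a where E: "finite E" "pairwise orthogonal E" "\<And>v. v \<in> E \<Longrightarrow> norm v = 1"
    "span E = UNIV" "\<And>v. v \<in> E \<Longrightarrow> A *v v = a v *\<^sub>R v"
    using symmetric_mat_eigenbasis[OF assms] by blast
  let ?F = "{v \<in> E. a v \<noteq> 0}"
  have "v \<in> range ((*v) A)" if "v \<in> ?F" for v
  proof
    show "v = A *v ((1 / a v) *\<^sub>R v)"
      using that E(5) by (simp add: matrix_vector_mult_scaleR)
  qed simp
  moreover have "independent ?F"
  proof (rule pairwise_orthogonal_independent)
    show "pairwise orthogonal ?F" using E(2) by (rule pairwise_subset) auto
    show "0 \<notin> ?F" using E(3) by fastforce
  qed
  ultimately have card: "card ?F \<le> rank A"
    unfolding rank_dim_range by (intro independent_card_le_dim) auto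
  have "A = (\<Sum>v\<in>E. a v *\<^sub>R outer v)" using E by (rule eigenbasis_decomposition)
  also have "\<dots> = (\<Sum>v\<in>?F. a v *\<^sub>R outer v)"
    by (rule sum.mono_neutral_right) (use E(1) in auto)
  finally have A: "A = (\<Sum>v\<in>?F. a v *\<^sub>R outer v)" .
  have "schatten1 A = (\<Sum>v\<in>E. \<bar>a v\<bar>)" using assms E by (rule schatten1_eq_sum_eigenvalues)
  also have "\<dots> = (\<Sum>v\<in>?F. \<bar>a v\<bar>)"
    by (rule sum.mono_neutral_right) (use E(1) in auto)
  finally have "unit_decomposition A ?F a"
    using A E(1,3) by (auto simp: unit_decomposition_def)
  then show ?thesis using card by blast
qed

lemma schatten1_psd: "psd X \<Longrightarrow> schatten1 X = trace X"
  using psd_sqrt_eqI[of X "X ** X"] by (simp add: schatten1_def psd_def symmetric_mat_def)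

section \<open>Trace estimates and feasible points of the sketched program\<close>

text \<open>The factor \<open>t\<close> lets one estimate serve twice: \<open>t = 1\<close> with
  \<open>g\<close> the sketch bounds the sketching error, and \<open>t = 0\<close> with
  \<open>g\<close> the identity bounds \<open>Tr (AX)\<close> itself.\<close>

lemma unit_decomposition_trace_diff_le:
  assumes A: "unit_decomposition A E a" and X: "unit_decomposition X F b"
    and c: "\<And>v u. v \<in> E \<Longrightarrow> u \<in> F \<Longrightarrow> \<bar>(g v \<bullet> g u)\<^sup>2 - t * (v \<bullet> u)\<^sup>2\<bar> \<le> c"
  shows "\<bar>trace ((\<Sum>v\<in>E. a v *\<^sub>R outer (g v)) ** (\<Sum>u\<in>F. b u *\<^sub>R outer (g u))) - t * trace (A ** X)\<bar>
    \<le> c * schatten1 A * schatten1 X"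
proof -
  have "trace (A ** X) = (\<Sum>v\<in>E. \<Sum>u\<in>F. a v * b u * (v \<bullet> u)\<^sup>2)"
    using A X trace_outer_sums[of a "\<lambda>v. v" E b "\<lambda>v. v" F] by (simp add: unit_decomposition_def)
  then have "\<bar>trace ((\<Sum>v\<in>E. a v *\<^sub>R outer (g v)) ** (\<Sum>u\<in>F. b u *\<^sub>R outer (g u))) - t * trace (A ** X)\<bar>
      = \<bar>\<Sum>v\<in>E. \<Sum>u\<in>F. a v * b u * ((g v \<bullet> g u)\<^sup>2 - t * (v \<bullet> u)\<^sup>2)\<bar>"
    by (simp add: trace_outer_sums sum_subtractf[symmetric] sum_distrib_left right_diff_distrib mult_ac)
  also have "\<dots> \<le> (\<Sum>v\<in>E. \<Sum>u\<in>F. \<bar>a v * b u * ((g v \<bullet> g u)\<^sup>2 - t * (v \<bullet> u)\<^sup>2)\<bar>)"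
    by (intro order_trans[OF sum_abs] sum_mono sum_abs)
  also have "\<dots> \<le> (\<Sum>v\<in>E. \<Sum>u\<in>F. \<bar>a v\<bar> * \<bar>b u\<bar> * c)"
    unfolding abs_mult using c by (intro sum_mono mult_left_mono) auto
  also have "\<dots> = c * schatten1 A * schatten1 X"
  proof -
    have "schatten1 A = (\<Sum>v\<in>E. \<bar>a v\<bar>)" "schatten1 X = (\<Sum>u\<in>F. \<bar>b u\<bar>)"
      using A X by (auto simp: unit_decomposition_def)
    then show ?thesis by (simp add: sum_product sum_distrib_left mult_ac)
  qed
  finally show ?thesis .
qed

lemma abs_trace_mult_le:
  assumes "symmetric_mat A" "symmetric_mat X"
  shows "\<bar>trace (A ** X)\<bar> \<le> schatten1 A * schatten1 X"
proof -
  obtain E a F b where A: "unit_decomposition A E a" and X: "unit_decomposition X F b"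
    using assms symmetric_mat_unit_decomposition by metis
  have "(v \<bullet> u)\<^sup>2 \<le> 1" if "v \<in> E" "u \<in> F" for v u
    using that A X Cauchy_Schwarz_ineq2[of v u] by (simp add: unit_decomposition_def abs_square_le_1)
  then show ?thesis
    using unit_decomposition_trace_diff_le[OF A X, of "\<lambda>v. v" 0 1] A X
    by (simp add: unit_decomposition_def)
qed

text \<open>Source of the constant 3: \<open>\<bar>x + y\<bar> \<le> \<bar>x - y\<bar> + 2 *
  \<bar>y\<bar> \<le> 3\<close>, where \<open>\<epsilon> \<le> 1\<close> enters.\<close>

lemma abs_diff_squares_le:
  fixes x y \<epsilon> :: real
  assumes "\<bar>x - y\<bar> \<le> \<epsilon>" "\<bar>y\<bar> \<le> 1" "\<epsilon> \<le> 1"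
  shows "\<bar>x\<^sup>2 - y\<^sup>2\<bar> \<le> 3 * \<epsilon>"
proof -
  have "\<bar>x\<^sup>2 - y\<^sup>2\<bar> = \<bar>x - y\<bar> * \<bar>x + y\<bar>"
    by (simp add: power2_eq_square abs_mult[symmetric] algebra_simps)
  also have "\<dots> \<le> \<epsilon> * 3"
    using assms by (intro mult_mono) auto
  finally show ?thesis by simp
qed

lemma sketch_trace_diff_le:
  fixes S :: "real^'n^'d"
  assumes A: "unit_decomposition A E a" and X: "unit_decomposition X F b" and "\<epsilon> \<le> 1"
    and jl: "\<And>v u. v \<in> E \<Longrightarrow> u \<in> F \<Longrightarrow> \<bar>(S *v v) \<bullet> (S *v u) - v \<bullet> u\<bar> \<le> \<epsilon> * norm v * norm u"
  shows "\<bar>trace (sketch S A ** sketch S X) - trace (A ** X)\<bar> \<le> 3 * \<epsilon> * schatten1 A * schatten1 X"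
proof -
  have "\<bar>((S *v v) \<bullet> (S *v u))\<^sup>2 - 1 * (v \<bullet> u)\<^sup>2\<bar> \<le> 3 * \<epsilon>" if "v \<in> E" "u \<in> F" for v u
    using that A X Cauchy_Schwarz_ineq2[of v u] jl[OF that] \<open>\<epsilon> \<le> 1\<close>
    by (simp add: unit_decomposition_def abs_diff_squares_le)
  from unit_decomposition_trace_diff_le[OF A X this]
  show ?thesis
    using A X sketch_outer_sum[of S a E] sketch_outer_sum[of S b F]
    by (simp add: unit_decomposition_def)
qed

lemma psd_sketch:
  assumes "psd X"
  shows "psd (sketch S X)"
proof -
  have "x \<bullet> (sketch S X *v x) = (x v* S) \<bullet> (X *v (x v* S))" for x
    unfolding sketch_def dot_lmul_matrix
    by (simp flip: matrix_vector_mul_assoc)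
  then show ?thesis
    using assms unfolding psd_def symmetric_mat_def
    by (simp add: sketch_def matrix_transpose_mul matrix_mul_assoc)
qed

lemma psd_0: "psd 0"
  by (simp add: psd_def symmetric_mat_def transpose_def vec_eq_iff)

text \<open>The relaxation of the constraints absorbs the error of the candidate \<open>Y\<close>.
  It stays free because both the sketch of the optimal point and \<open>0\<close> are used.\<close>

lemma sketched_sdp_value_ge:
  fixes S :: "real^'n^'d"
  assumes "X \<in> sdp_feasible m B \<gamma>" "psd Y"
    and "\<And>i. i \<in> {1..m} \<Longrightarrow>
      \<bar>trace (sketch S (B i) ** Y) - trace (B i ** X)\<bar> \<le> 3 * \<epsilon> * \<eta> * schatten1 (B i)"
    and "\<bar>trace (sketch S A ** Y) - trace (A ** X)\<bar> \<le> 3 * \<epsilon> * \<eta> * schatten1 A"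
  shows "ereal (trace (A ** X) - 3 * \<epsilon> * \<eta> * schatten1 A) \<le> sketched_sdp_value m A B \<gamma> \<eta> \<epsilon> S"
  unfolding sketched_sdp_value_def Let_def sdp_value_def
proof (rule SUP_upper2)
  show "Y \<in> sdp_feasible m (\<lambda>i. sketch S (B i)) (\<lambda>i. \<gamma> i + 3 * \<epsilon> * \<eta> * schatten1 (B i))"
    unfolding sdp_feasible_def
  proof (intro CollectI conjI ballI)
    fix i assume i: "i \<in> {1..m}"
    then have "trace (B i ** X) \<le> \<gamma> i" using assms(1) by (simp add: sdp_feasible_def)
    then show "trace (sketch S (B i) ** Y) \<le> \<gamma> i + 3 * \<epsilon> * \<eta> * schatten1 (B i)"
      using assms(3)[OF i] by linarith
  qed fact
qed (use assms(4) in \<open>simp add: abs_le_iff\<close>)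

section \<open>Measurability of the sketched value\<close>

lemma continuous_on_trace_sketch:
  "continuous_on UNIV (\<lambda>p. trace (sketch (fst p) A ** snd p))"
  unfolding sketch_def trace_def matrix_matrix_mult_def transpose_def
  by (simp, intro continuous_intros)

lemma closed_psd: "closed {p. psd (snd p :: real^'n^'n)}"
  unfolding psd_def symmetric_mat_def transpose_def matrix_vector_mult_def
  by (intro closed_Collect_conj closed_Collect_all closed_Collect_eq closed_Collect_le continuous_intros)

text \<open>The projection of a closed set can fail to be closed, so \<open>C\<close> is cut into
  compact pieces, whose images are compact.\<close>

lemma fst_closed_borel:
  fixes C :: "('a::euclidean_space \<times> 'b::euclidean_space) set"
  assumes "closed C"
  shows "fst ` C \<in> sets borel"
proof -
  have "C = (\<Union>n. C \<inter> cball 0 (real n))"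
    using real_arch_simple by fastforce
  then have "fst ` C = (\<Union>n. fst ` (C \<inter> cball 0 (real n)))" by (metis image_UN)
  moreover have "closed (fst ` (C \<inter> cball 0 (real n)))" for n
    by (intro compact_imp_closed compact_continuous_image continuous_intros
        closed_Int_compact assms compact_cball)
  ultimately show ?thesis by (auto intro!: sets.countable_UN borel_closed)
qed

text \<open>A superlevel set is a countable intersection of projections of closed sets, and the
  projection of a closed, hence \<open>\<sigma>\<close>-compact, subset of a Euclidean space is Borel.\<close>

lemma sketched_sdp_value_superlevel_borel:
  fixes A :: "real^'n^'n"
  shows "{S :: real^'n^'d. ereal r \<le> sketched_sdp_value m A B \<gamma> \<eta> \<epsilon> S} \<in> sets borel"
proof -
  define g where "g i = \<gamma> i + 3 * \<epsilon> * \<eta> * schatten1 (B i)" for i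
  \<comment> \<open>Pairs of a sketch and a feasible point. The slack \<open>1 / Suc n\<close> is
    there because the supremum may not be attained.\<close>
  define C where "C n = {p :: (real^'n^'d) \<times> (real^'d^'d). psd (snd p) \<and>
      (\<forall>i. i \<in> {1..m} \<longrightarrow> trace (sketch (fst p) (B i) ** snd p) \<le> g i) \<and>
      r - 1 / real (Suc n) \<le> trace (sketch (fst p) A ** snd p)}" for n
  have "closed (C n)" for n
    unfolding C_def
    by (intro closed_Collect_conj closed_psd closed_Collect_all closed_Collect_imp closed_Collect_le
        continuous_on_trace_sketch continuous_intros open_Collect_const)
  moreover have "{S. ereal r \<le> sketched_sdp_value m A B \<gamma> \<eta> \<epsilon> S} = (\<Inter>n. fst ` C n)"
  proof (intro set_eqI iffI)
    fix S :: "real^'n^'d"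
    let ?F = "sdp_feasible m (\<lambda>i. sketch S (B i)) g"
    have val: "sketched_sdp_value m A B \<gamma> \<eta> \<epsilon> S = (SUP Y\<in>?F. ereal (trace (sketch S A ** Y)))"
      unfolding sketched_sdp_value_def sdp_value_def Let_def g_def ..
    {
      assume "S \<in> {S. ereal r \<le> sketched_sdp_value m A B \<gamma> \<eta> \<epsilon> S}"
      show "S \<in> (\<Inter>n. fst ` C n)"
      proof
        fix n
        have "ereal (r - 1 / real (Suc n)) < ereal r" by simp
        also have "\<dots> \<le> (SUP Y\<in>?F. ereal (trace (sketch S A ** Y)))"
          using \<open>S \<in> _\<close> val by simp
        finally obtain Y where "Y \<in> ?F" "r - 1 / real (Suc n) < trace (sketch S A ** Y)"
          by (auto simp: less_SUP_iff)
        then have "(S, Y) \<in> C n" by (auto simp: C_def sdp_feasible_def)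
        then show "S \<in> fst ` C n" by force
      qed
    next
      assume S: "S \<in> (\<Inter>n. fst ` C n)"
      have "ereal (r - 1 / real (Suc n)) \<le> sketched_sdp_value m A B \<gamma> \<eta> \<epsilon> S" for n
      proof -
        obtain Y where "(S, Y) \<in> C n" using S by force
        then show ?thesis
          unfolding val by (intro SUP_upper2[of Y]) (auto simp: C_def sdp_feasible_def)
      qed
      moreover have "(\<lambda>n. ereal (r - 1 / real (Suc n))) \<longlonglongrightarrow> ereal (r - 0)"
        by (intro tendsto_intros LIMSEQ_Suc[OF lim_1_over_n])
      ultimately show "S \<in> {S. ereal r \<le> sketched_sdp_value m A B \<gamma> \<eta> \<epsilon> S}"
        using LIMSEQ_le_const2 by fastforce
    }
  qed
  ultimately show ?thesis by (auto intro!: sets.countable_INT fst_closed_borel)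
qed

section \<open>The probability bound\<close>

text \<open>The Johnson-Lindenstrauss property concerns sets of exactly \<open>k\<close> vectors,
  while the eigenvectors may be fewer and have to be padded.\<close>

lemma finite_superset_with_card:
  fixes W :: "'a set"
  assumes "infinite (UNIV :: 'a set)" "finite W" "card W \<le> k"
  obtains V where "W \<subseteq> V" "finite V" "card V = k"
proof -
  have "infinite (- W)" using assms by (metis finite_compl)
  then obtain T where "T \<subseteq> - W" "finite T" "card T = k - card W"
    using infinite_arbitrarily_large by metis
  then have "card (W \<union> T) = k"
    using assms by (subst card_Un_disjoint) auto
  then show thesis using that[of "W \<union> T"] assms \<open>finite T\<close> by auto
qed

theorem theorem5p3:
  fixes A :: "real^'D^'D" and B :: "nat \<Rightarrow> real^'D^'D"
    and \<gamma> :: "nat \<Rightarrow> real" and m k :: nat and \<eta> \<epsilon> \<delta> :: real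
    and Xopt :: "real^'D^'D"
    and M :: "'w measure" and S :: "'w \<Rightarrow> real^'D^'d"
  assumes "symmetric_mat A"
    and "\<And>i. i \<in> {1..m} \<Longrightarrow> symmetric_mat (B i)"
    and "\<epsilon> > 0"
    and "sdp_optimal m A B \<gamma> Xopt"
    and "trace Xopt \<le> \<eta>"
    and "jl_transform M S \<epsilon> \<delta> k"
    and "k \<ge> rank Xopt + rank A + (\<Sum>i=1..m. rank (B i))"
  shows "measure M {\<omega> \<in> space M.
           sketched_sdp_value m A B \<gamma> \<eta> \<epsilon> (S \<omega>) + ereal (3 * \<epsilon> * \<eta> * schatten1 A)
             \<ge> sdp_value m A B \<gamma>} \<ge> 1 - \<delta>"
proof -
  interpret prob_space M using assms(6) by (simp add: jl_transform_def)
  have symA: "symmetric_mat A" and symB: "\<And>i. i \<in> {1..m} \<Longrightarrow> symmetric_mat (B i)" by fact+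
  have feas: "Xopt \<in> sdp_feasible m B \<gamma>"
    and opt: "sdp_value m A B \<gamma> = ereal (trace (A ** Xopt))"
    using assms(4) by (auto simp: sdp_optimal_def)
  then have psdX: "psd Xopt" by (simp add: sdp_feasible_def)
  then have symX: "symmetric_mat Xopt" by (simp add: psd_def)
  obtain E a where A: "unit_decomposition A E a" "card E \<le> rank A"
    using symmetric_mat_unit_decomposition[OF symA] by blast
  obtain F b where X: "unit_decomposition Xopt F b" "card F \<le> rank Xopt"
    using symmetric_mat_unit_decomposition[OF symX] by blast
  obtain G c where B: "\<And>i. i \<in> {1..m} \<Longrightarrow> unit_decomposition (B i) (G i) (c i)"
      "\<And>i. i \<in> {1..m} \<Longrightarrow> card (G i) \<le> rank (B i)"
    using symmetric_mat_unit_decomposition[OF symB] by metis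
  \<comment> \<open>\<open>Xopt\<close> is positive semidefinite, so its Schatten norm is its trace,
    at most \<open>\<eta>\<close>.\<close>
  have schatten1_mult_le: "schatten1 C * schatten1 Xopt \<le> \<eta> * schatten1 C"
    if "unit_decomposition C H h" for C H h
  proof -
    have "0 \<le> schatten1 C" using that by (auto simp: unit_decomposition_def intro!: sum_nonneg)
    then show ?thesis
      using mult_left_mono[OF assms(5), of "schatten1 C"] by (simp add: schatten1_psd[OF psdX] mult.commute)
  qed
  define r where "r = trace (A ** Xopt) - 3 * \<epsilon> * \<eta> * schatten1 A"
  define T where "T = {\<omega> \<in> space M. ereal r \<le> sketched_sdp_value m A B \<gamma> \<eta> \<epsilon> (S \<omega>)}"
  have "S \<in> borel_measurable M" using assms(6) by (simp add: jl_transform_def)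
  from measurable_sets[OF this sketched_sdp_value_superlevel_borel]
  have T_sets: "T \<in> sets M"
    by (simp add: T_def vimage_def Int_def conj_commute)
  define W where "W = F \<union> E \<union> (\<Union>i\<in>{1..m}. G i)"
  have "finite W" using A X B by (auto simp: W_def unit_decomposition_def)
  have "card W \<le> card F + card E + (\<Sum>i=1..m. card (G i))"
    unfolding W_def by (intro order_trans[OF card_Un_le] add_mono card_Un_le card_UN_le) auto
  also have "\<dots> \<le> rank Xopt + rank A + (\<Sum>i=1..m. rank (B i))"
    using A X B by (intro add_mono sum_mono) auto
  also have "\<dots> \<le> k" by fact
  finally have "card W \<le> k" .
  moreover have "infinite (UNIV :: (real^'D) set)"
    using finite_imp_bounded not_bounded_UNIV by blast
  ultimately obtain V where V: "W \<subseteq> V" "finite V" "card V = k"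
    using finite_superset_with_card \<open>finite W\<close> by blast
  define J where "J = {\<omega> \<in> space M. \<forall>v\<in>V. \<forall>w\<in>V.
          \<bar>(S \<omega> *v v) \<bullet> (S \<omega> *v w) - v \<bullet> w\<bar> \<le> \<epsilon> * norm v * norm w}"
  have "ereal r \<le> sketched_sdp_value m A B \<gamma> \<eta> \<epsilon> (S \<omega>)" if "\<omega> \<in> J" for \<omega>
  proof (cases "\<epsilon> \<le> 1")
    case True
    \<comment> \<open>Stated for a general \<open>C\<close>, to serve the objective and every
      constraint.\<close>
    have close: "\<bar>trace (sketch (S \<omega>) C ** sketch (S \<omega>) Xopt) - trace (C ** Xopt)\<bar>
        \<le> 3 * \<epsilon> * \<eta> * schatten1 C"
      if "unit_decomposition C H h" "H \<subseteq> W" for C H h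
    proof -
      have "H \<subseteq> V" using \<open>H \<subseteq> W\<close> V(1) by (rule order_trans)
      moreover have "F \<subseteq> V" using V(1) by (simp add: W_def)
      ultimately have "\<bar>trace (sketch (S \<omega>) C ** sketch (S \<omega>) Xopt) - trace (C ** Xopt)\<bar>
          \<le> 3 * \<epsilon> * schatten1 C * schatten1 Xopt"
        using \<open>\<omega> \<in> J\<close> by (intro sketch_trace_diff_le[OF that(1) X(1) True]) (auto simp: J_def)
      also have "\<dots> \<le> 3 * \<epsilon> * \<eta> * schatten1 C"
        using mult_left_mono[OF schatten1_mult_le[OF that(1)], of "3 * \<epsilon>"] assms(3)
        by (simp add: mult.assoc)
      finally show ?thesis .
    qed
    have "E \<subseteq> W" "\<And>i. i \<in> {1..m} \<Longrightarrow> G i \<subseteq> W" by (auto simp: W_def)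
    then show ?thesis
      unfolding r_def
      by (intro sketched_sdp_value_ge[OF feas psd_sketch[OF psdX, of "S \<omega>"]] close[OF A(1)] close[OF B(1)])
  next
    \<comment> \<open>Here \<open>2 \<epsilon> + \<epsilon>\<^sup>2 > 3 \<epsilon>\<close>, so the sketch of the optimal point can fail to be feasible.\<close>
    case False
    have small: "\<bar>trace (C ** Xopt)\<bar> \<le> 3 * \<epsilon> * \<eta> * schatten1 C" if symC: "symmetric_mat C" for C
    proof -
      obtain H h where H: "unit_decomposition C H h"
        using symmetric_mat_unit_decomposition[OF symC] by blast
      have le: "\<bar>trace (C ** Xopt)\<bar> \<le> \<eta> * schatten1 C"
        using abs_trace_mult_le[OF symC symX] schatten1_mult_le[OF H] by (rule order_trans)
      \<comment> \<open>The bound \<open>le\<close> on an absolute value also shows that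
        \<open>\<eta> * schatten1 C\<close> is nonnegative.\<close>
      moreover have "1 * (\<eta> * schatten1 C) \<le> (3 * \<epsilon>) * (\<eta> * schatten1 C)"
        using False le by (intro mult_right_mono) auto
      ultimately show ?thesis by (simp add: mult.assoc)
    qed
    have "trace (C ** 0) = 0" for C :: "real^'d^'d"
      by (simp add: trace_def matrix_matrix_mult_def)
    then show ?thesis
      unfolding r_def using small[OF symA] small[OF symB]
      by (intro sketched_sdp_value_ge[OF feas psd_0]) simp_all
  qed
  then have "J \<subseteq> T" by (auto simp: J_def T_def)
  have "1 - \<delta> \<le> measure M J"
    using assms(6) V(2,3) unfolding jl_transform_def J_def by blast
  \<comment> \<open>Monotonicity asks for measurability of the larger set \<open>T\<close>, supplied
    by the Borel superlevel sets.\<close>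
  also have "\<dots> \<le> measure M T"
    using \<open>J \<subseteq> T\<close> T_sets by (rule finite_measure_mono)
  also have "T = {\<omega> \<in> space M. sketched_sdp_value m A B \<gamma> \<eta> \<epsilon> (S \<omega>)
      + ereal (3 * \<epsilon> * \<eta> * schatten1 A) \<ge> sdp_value m A B \<gamma>}"
  proof -
    \<comment> \<open>Moving a finite real across the inequality is sound for infinite
      \<open>z\<close> too.\<close>
    have "ereal r \<le> z \<longleftrightarrow> sdp_value m A B \<gamma> \<le> z + ereal (3 * \<epsilon> * \<eta> * schatten1 A)" for z
      by (cases z) (auto simp: opt r_def)
    then show ?thesis by (simp add: T_def)
  qed
  finally show ?thesis .
qed

end
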